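(* Let $p'\in\mathbb Z$, let $(p,q)$ be coprime integers with $q\ne0$, let $r\ge3$ be odd, and let $\check f_r(s,m,n,l)$ be the Fourier coefficients defined in the context. Then for all $s\in\{0,\dots,|q|-1\}$ and $m,n,l\in\mathbb Z$ $$\check f_r(s,m,n,l)=(-1)^{p'+l}\,\check f_r(s,m,n,-2p'-2-l).$$
   Context: $\mathrm i=\sqrt{-1}$. Arithmetic data: choose integers with $p\tilde p+q\tilde q=1$ and $\begin{pmatrix}p&-\tilde q\\ q&\tilde p\end{pmatrix}=T^{a_k}S\cdots T^{a_1}S$, $S=\begin{pmatrix}0&-1\\ 1&0\end{pmatrix}$, $T=\begin{pmatrix}1&1\\ 0&1\end{pmatrix}$, $a_j\in\mathbb Z$; $C_j$ is the lower-left entry of $T^{a_j}S\cdots T^{a_1}S$, assumed nonzero for $1\le j\le k$ ($C_k=q$; $C_0=0$, and terms with factor $C_0$ are read as $0$). $K_j=\frac{(-1)^{j+1}\sum_{h=1}^ja_hC_h}{C_j}$. For $s\in\{0,\dots,|q|-1\}$: $I(s)=-C_{k-1}(2s+1+K_{k-1})$, $J(s)=\frac{2s+1}q+(-1)^k\sum_{j=1}^{k-1}\frac{(-1)^{j+1}K_j}{C_{j+1}}$, $K(s)=\frac{C_{k-1}(2s+1+K_{k-1})^2}q+\sum_{j=1}^{k-2}\frac{C_jK_j^2}{C_{j+1}}$. For $m\in\mathbb Z$: $\kappa(s,m)=\frac{I(s)}q+1-2m$. Quantum dilogarithm: $\varphi_r(z)=\frac{4\pi\mathrm i}r\int_\Omega\frac{e^{(2z-\pi)x}}{4x\sinh(\pi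 x)\sinh(2\pi x/r)}dx$ for $-\frac\pi r<\mathrm{Re}\,z<\pi+\frac\pi r$, where $\Omega=(-\infty,-\eta]\cup\{|x|=\eta,\mathrm{Im}\,x\ge0\}\cup[\eta,\infty)$, $\eta\in(0,1)$, left to right. Regions: for $\epsilon\ge0$, $D_\epsilon=\{(x,y,z)\in\mathbb R^3: |x|<\frac\pi4-\epsilon,\ y-x>\epsilon,\ x+y>\epsilon,\ z-y>\epsilon,\ y+z<\pi-\epsilon,\ y+2z<\frac74\pi-\epsilon,\ 2z-y>\frac\pi4+\epsilon\}$. Fix a small $\epsilon>0$ and a $C^\infty$ function $\psi$ on $\mathbb R^3$ with $\psi=1$ on $\overline{D_\epsilon}$, $0<\psi<1$ on $D_{\epsilon/2}\setminus\overline{D_\epsilon}$, $\psi=0$ outside $D_{\epsilon/2}$, and $\psi(x,y,z)=\psi(-x,y,z)=\psi(x,y,\pi-z)$. Potential function: on $D_0$, $V_r(x,y,z,s,m,n,l)=\varphi_r(y+x+\frac\pi r)+\varphi_r(y-x+\frac\pi r)+\varphi_r(z-y)+\varphi_r(\pi-y-z)-\varphi_r(\pi-y-\frac\pi r)-\varphi_r(\frac\pi r)-\frac{p+2q}qx^2-4y^2-(4p'+2)z^2+2\pi\kappa(s,m)x-4\pi ny-2\pi(2l+1)z+K(s)\pi^2-\frac{\pi^2}3-\frac{4\pi}r(x+y)+\frac{2\pi^2}r-\frac{\pi^2}{3r^2}$. Fourier coefficients: $\check f_r(s,m,n,l)=4(-1)^{m+n+l}\big(\frac r{2\pi}\big)^3\int_{D_{\epsilon/2}}\psi(x,y,z)\sin\big(\tfrac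 xq-J(s)\pi\big)\sin(2z)\,e^{-\mathrm i(x+y)+\frac r{4\pi\mathrm i}V_r(x,y,z,s,m,n,l)}\,dx\,dy\,dz$. *)

theory Defs
  imports "HOL-Complex_Analysis.Complex_Analysis"
begin

definition S_mat :: "int^2^2" where
  "S_mat = vector [vector [0, -1], vector [1, 0]]"

definition T_mat :: "int^2^2" where
  "T_mat = vector [vector [1, 1], vector [0, 1]]"

definition mat_zpow :: "'a::semiring_1^'n^'n \<Rightarrow> int \<Rightarrow> 'a^'n^'n" where
  "mat_zpow A i =
     (if 0 \<le> i then (((**) A) ^^ nat i) (mat 1)
      else (((**) (matrix_inv A)) ^^ nat (- i)) (mat 1))"

primrec TS_word :: "(nat \<Rightarrow> int) \<Rightarrow> nat \<Rightarrow> int^2^2" where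
  "TS_word a 0 = mat 1"
| "TS_word a (Suc j) = mat_zpow T_mat (a (Suc j)) ** S_mat ** TS_word a j"

definition C_seq :: "(nat \<Rightarrow> int) \<Rightarrow> nat \<Rightarrow> int" where
  "C_seq a j = TS_word a j $ 2 $ 1"

text \<open>
  The index 0 occurs below only in the form \<open>C_seq a 0 * \<dots>\<close>. Since
  \<open>C_seq a 0 = 0\<close>, such terms vanish, whatever the value of \<open>K_seq a 0\<close>.
\<close>

definition K_seq :: "(nat \<Rightarrow> int) \<Rightarrow> nat \<Rightarrow> real" where
  "K_seq a j = (-1) ^ (j + 1) * (\<Sum>h=1..j. of_int (a h * C_seq a h)) / of_int (C_seq a j)"

text \<open>For \<open>q \<noteq> 0\<close> the matrix identity forces \<open>k \<ge> 1\<close>, since \<open>C_seq a 0 = 0\<close>.\<close>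

definition arithmetic_data ::
  "int \<Rightarrow> int \<Rightarrow> int \<Rightarrow> int \<Rightarrow> (nat \<Rightarrow> int) \<Rightarrow> nat \<Rightarrow> bool" where
  "arithmetic_data p q pt qt a k \<longleftrightarrow>
     p * pt + q * qt = 1 \<and>
     vector [vector [p, - qt], vector [q, pt]] = TS_word a k \<and>
     (\<forall>j\<in>{1..k}. C_seq a j \<noteq> 0)"

definition I_fun :: "(nat \<Rightarrow> int) \<Rightarrow> nat \<Rightarrow> int \<Rightarrow> real" where
  "I_fun a k s = - of_int (C_seq a (k - 1)) * (2 * of_int s + 1 + K_seq a (k - 1))"

definition J_fun :: "(nat \<Rightarrow> int) \<Rightarrow> nat \<Rightarrow> int \<Rightarrow> int \<Rightarrow> real" where
  "J_fun a k q s =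
     (2 * of_int s + 1) / of_int q
     + (-1) ^ k * (\<Sum>j=1..k - 1. (-1) ^ (j + 1) * K_seq a j / of_int (C_seq a (j + 1)))"

definition K_fun :: "(nat \<Rightarrow> int) \<Rightarrow> nat \<Rightarrow> int \<Rightarrow> int \<Rightarrow> real" where
  "K_fun a k q s =
     of_int (C_seq a (k - 1)) * (2 * of_int s + 1 + K_seq a (k - 1))\<^sup>2 / of_int q
     + (\<Sum>j=1..k - 2. of_int (C_seq a j) * (K_seq a j)\<^sup>2 / of_int (C_seq a (j + 1)))"

definition kappa :: "(nat \<Rightarrow> int) \<Rightarrow> nat \<Rightarrow> int \<Rightarrow> int \<Rightarrow> int \<Rightarrow> real" where
  "kappa a k q s m = I_fun a k s / of_int q + 1 - 2 * of_int m"

definition qdilog_integrand :: "nat \<Rightarrow> complex \<Rightarrow> complex \<Rightarrow> complex" where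
  "qdilog_integrand r z x =
     exp ((2 * z - of_real pi) * x) /
     (4 * x * sinh (of_real pi * x) * sinh (2 * of_real pi * x / of_nat r))"

text \<open>
  The contour consists of the ray to \<open>-\<eta>\<close>, the upper half circle of radius \<open>\<eta>\<close>
  (traversed from angle \<open>pi\<close> down to \<open>0\<close>) and the ray from \<open>\<eta>\<close>. The defining
  integral converges absolutely for \<open>- pi / r < Re z < pi + pi / r\<close>; the definition is
  meaningful only there.
\<close>

definition qdilog :: "real \<Rightarrow> nat \<Rightarrow> complex \<Rightarrow> complex" where
  "qdilog \<eta> r z =
     4 * of_real pi * \<i> / of_nat r *
     ((LINT x:{..-\<eta>}|lborel. qdilog_integrand r z (of_real x))
      + contour_integral (part_circlepath 0 \<eta> pi 0) (qdilog_integrand r z)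
      + (LINT x:{\<eta>..}|lborel. qdilog_integrand r z (of_real x)))"

definition D_region :: "real \<Rightarrow> (real \<times> real \<times> real) set" where
  "D_region \<epsilon> = {(x, y, z).
     \<bar>x\<bar> < pi / 4 - \<epsilon> \<and> y - x > \<epsilon> \<and> x + y > \<epsilon> \<and> z - y > \<epsilon> \<and>
     y + z < pi - \<epsilon> \<and> y + 2 * z < 7 / 4 * pi - \<epsilon> \<and> 2 * z - y > pi / 4 + \<epsilon>}"

text \<open>
  \<open>C_order n f\<close>: all iterated directional derivatives of \<open>f\<close> of order below \<open>n\<close> are
  (Frechet) differentiable everywhere, and those of order \<open>n\<close> are continuous.
\<close>

primrec C_order :: "nat \<Rightarrow> ('a::real_normed_vector \<Rightarrow> 'b::real_normed_vector) \<Rightarrow> bool" where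
  "C_order 0 f \<longleftrightarrow> continuous_on UNIV f"
| "C_order (Suc n) f \<longleftrightarrow>
     (\<forall>x. f differentiable (at x)) \<and> (\<forall>v. C_order n (\<lambda>x. frechet_derivative f (at x) v))"

definition C_infinity :: "('a::real_normed_vector \<Rightarrow> 'b::real_normed_vector) \<Rightarrow> bool" where
  "C_infinity f \<longleftrightarrow> (\<forall>n. C_order n f)"

definition cutoff :: "real \<Rightarrow> (real \<times> real \<times> real \<Rightarrow> real) \<Rightarrow> bool" where
  "cutoff \<epsilon> \<psi> \<longleftrightarrow>
     C_infinity \<psi> \<and>
     (\<forall>v\<in>closure (D_region \<epsilon>). \<psi> v = 1) \<and>
     (\<forall>v\<in>D_region (\<epsilon> / 2) - closure (D_region \<epsilon>). 0 < \<psi> v \<and> \<psi> v < 1) \<and>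
     (\<forall>v. v \<notin> D_region (\<epsilon> / 2) \<longrightarrow> \<psi> v = 0) \<and>
     (\<forall>x y z. \<psi> (x, y, z) = \<psi> (- x, y, z) \<and> \<psi> (x, y, z) = \<psi> (x, y, pi - z))"

definition potential ::
  "real \<Rightarrow> nat \<Rightarrow> int \<Rightarrow> int \<Rightarrow> int \<Rightarrow> (nat \<Rightarrow> int) \<Rightarrow> nat \<Rightarrow>
   real \<Rightarrow> real \<Rightarrow> real \<Rightarrow> int \<Rightarrow> int \<Rightarrow> int \<Rightarrow> int \<Rightarrow> complex" where
  "potential \<eta> r p' p q a k x y z s m n l =
     qdilog \<eta> r (of_real (y + x + pi / of_nat r))
     + qdilog \<eta> r (of_real (y - x + pi / of_nat r))
     + qdilog \<eta> r (of_real (z - y))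
     + qdilog \<eta> r (of_real (pi - y - z))
     - qdilog \<eta> r (of_real (pi - y - pi / of_nat r))
     - qdilog \<eta> r (of_real (pi / of_nat r))
     + of_real
        (- (of_int (p + 2 * q) / of_int q) * x\<^sup>2 - 4 * y\<^sup>2 - of_int (4 * p' + 2) * z\<^sup>2
         + 2 * pi * kappa a k q s m * x - 4 * pi * of_int n * y
         - 2 * pi * of_int (2 * l + 1) * z
         + K_fun a k q s * pi\<^sup>2 - pi\<^sup>2 / 3
         - 4 * pi / of_nat r * (x + y) + 2 * pi\<^sup>2 / of_nat r - pi\<^sup>2 / (3 * (of_nat r)\<^sup>2))"

definition fourier_coeff ::
  "real \<Rightarrow> real \<Rightarrow> (real \<times> real \<times> real \<Rightarrow> real) \<Rightarrow> nat \<Rightarrow>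
   int \<Rightarrow> int \<Rightarrow> int \<Rightarrow> (nat \<Rightarrow> int) \<Rightarrow> nat \<Rightarrow>
   int \<Rightarrow> int \<Rightarrow> int \<Rightarrow> int \<Rightarrow> complex" where
  "fourier_coeff \<eta> \<epsilon> \<psi> r p' p q a k s m n l =
     4 * (-1) powi (m + n + l) * (of_nat r / (2 * of_real pi)) ^ 3 *
     (LINT v:D_region (\<epsilon> / 2)|lborel.
        (case v of (x, y, z) \<Rightarrow>
          of_real (\<psi> (x, y, z) * sin (x / of_int q - J_fun a k q s * pi) * sin (2 * z)) *
          exp (- \<i> * of_real (x + y)
               + of_nat r / (4 * of_real pi * \<i>) * potential \<eta> r p' p q a k x y z s m n l)))"

end

theory Submission
  imports Defs
begin

text \<open>
  The substitution \<open>z \<mapsto> \<pi> - z\<close> preserves the region, the measure and the cutoff,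
  exchanges \<open>\<phi>\<^sub>r(z - y)\<close> with \<open>\<phi>\<^sub>r(\<pi> - y - z)\<close> and changes the sign of \<open>sin (2z)\<close>.
  It turns the potential for \<open>-2p' - 2 - l\<close> into the one for \<open>l\<close>, up to the
  constant \<open>4\<pi>\<^sup>2(p' + 1 + l)\<close>, which for odd \<open>r\<close> contributes the factor \<open>(-1)\<^bsup>p' + 1 + l\<^esup>\<close>.
\<close>

text \<open>Up to the translation by \<open>t\<close>, the map is diagonal in the standard basis
  with entries 1 and a single -1. Its Jacobian has absolute value 1, so the affine change of
  variables produces the density 1.\<close>

lemma lborel_reflect_Basis:
  fixes b t :: "'a::euclidean_space"
  assumes "b \<in> Basis"
  shows "distr lborel lborel (\<lambda>x. t + (x - (2 * (x \<bullet> b)) *\<^sub>R b)) = lborel"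
proof -
  define c where "c j = (if j = b then -1 else 1 :: real)" for j
  have "(\<Sum>j\<in>Basis. (c j * (x \<bullet> j)) *\<^sub>R j) = x - (2 * (x \<bullet> b)) *\<^sub>R b" for x
  proof -
    have "(\<Sum>j\<in>Basis. (c j * (x \<bullet> j)) *\<^sub>R j) =
        (\<Sum>j\<in>Basis. (x \<bullet> j) *\<^sub>R j - (if j = b then (2 * (x \<bullet> b)) *\<^sub>R b else 0))"
      by (intro sum.cong) (auto simp: c_def algebra_simps simp flip: scaleR_left_distrib)
    also have "\<dots> = x - (2 * (x \<bullet> b)) *\<^sub>R b"
      using assms by (simp add: sum_subtractf euclidean_representation)
    finally show ?thesis .
  qed
  moreover have "(\<Prod>j\<in>(Basis::'a set). \<bar>c j\<bar>) = 1"
    by (intro prod.neutral) (auto simp: c_def)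
  moreover have "c j \<noteq> 0" for j by (simp add: c_def)
  ultimately have "(lborel :: 'a measure) =
      density (distr lborel borel (\<lambda>x. t + (x - (2 * (x \<bullet> b)) *\<^sub>R b))) (\<lambda>_. 1)"
    using lborel_affine_euclidean[of c t] by simp
  also have "\<dots> = distr lborel lborel (\<lambda>x. t + (x - (2 * (x \<bullet> b)) *\<^sub>R b))"
    by (simp add: density_1 cong: distr_cong)
  finally show ?thesis by simp
qed

text \<open>The involution makes a measurability assumption on \<open>f\<close> superfluous.\<close>

lemma integral_involution:
  fixes f :: "'a \<Rightarrow> 'b::{banach, second_countable_topology}"
  assumes meas: "T \<in> M \<rightarrow>\<^sub>M M" and dist: "distr M M T = M" and inv: "\<And>x. T (T x) = x"
  shows "(\<integral>x. f (T x) \<partial>M) = (\<integral>x. f x \<partial>M)"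
proof (cases "integrable M f")
  case True
  then show ?thesis
    using integral_distr[OF meas, of f] dist by simp
next
  case False
  \<comment> \<open>Composing with \<open>T\<close> once more gives back \<open>f\<close>. Hence
    \<open>f\<close> and its composite with \<open>T\<close> fail to be integrable together, and
    both integrals take the default value 0.\<close>
  moreover have "integrable M f" if "integrable M (\<lambda>x. f (T x))"
    using integrable_distr[OF meas, of "\<lambda>x. f (T x)"] that dist inv by simp
  ultimately show ?thesis
    using not_integrable_integral_eq by metis
qed

lemma lborel_integral_reflect_third:
  fixes f :: "real \<times> real \<times> real \<Rightarrow> 'b::{banach, second_countable_topology}"
  shows "(\<integral>v. f (fst v, fst (snd v), c - snd (snd v)) \<partial>lborel) = (\<integral>v. f v \<partial>lborel)"
proof (rule integral_involution)
  \<comment> \<open>On the third coordinate, c - z = c + (z - 2 z).\<close>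
  have T: "(\<lambda>v::real \<times> real \<times> real. (fst v, fst (snd v), c - snd (snd v))) =
      (\<lambda>v. (0, 0, c) + (v - (2 * (v \<bullet> (0, 0, 1))) *\<^sub>R (0, 0, 1)))"
    by (auto simp: inner_prod_def)
  have "(0, 0, 1) \<in> (Basis :: (real \<times> real \<times> real) set)"
    by (simp add: Basis_prod_def zero_prod_def image_iff)
  then show "distr lborel lborel (\<lambda>v. (fst v, fst (snd v), c - snd (snd v))) =
      (lborel :: (real \<times> real \<times> real) measure)"
    unfolding T by (rule lborel_reflect_Basis)
  have "continuous_on UNIV (\<lambda>v::real \<times> real \<times> real. (fst v, fst (snd v), c - snd (snd v)))"
    by (intro continuous_intros)
  then show "(\<lambda>v::real \<times> real \<times> real. (fst v, fst (snd v), c - snd (snd v)))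
      \<in> lborel \<rightarrow>\<^sub>M lborel"
    by (simp add: borel_measurable_continuous_onI)
qed auto

text \<open>The bounds on z - y and y + z trade places, as do those on y + 2 z and 2 z - y; the
  others do not involve z.\<close>

lemma D_region_reflect: "(x, y, pi - z) \<in> D_region \<epsilon> \<longleftrightarrow> (x, y, z) \<in> D_region \<epsilon>"
  unfolding D_region_def by auto

text \<open>The index is forced by matching the terms linear in z: for l' = - 2 p' - 2 - l one has
  (4 p' + 2) + (2 l' + 1) = - (2 l + 1). The dilogarithm terms are merely permuted.\<close>

lemma potential_reflect:
  "potential \<eta> r p' p q a k x y (pi - z) s m n (- 2 * p' - 2 - l) =
   potential \<eta> r p' p q a k x y z s m n l + of_real (4 * pi\<^sup>2 * of_int (p' + 1 + l))"
proof -
  have "- of_int (4 * p' + 2) * (pi - z)\<^sup>2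
          - 2 * pi * of_int (2 * (- 2 * p' - 2 - l) + 1) * (pi - z)
        = - of_int (4 * p' + 2) * z\<^sup>2 - 2 * pi * of_int (2 * l + 1) * z
          + 4 * pi\<^sup>2 * of_int (p' + 1 + l)"
    by (simp add: power2_eq_square algebra_simps)
  then show ?thesis
    unfolding potential_def
    by (simp add: algebra_simps flip: of_real_add of_real_diff)
qed

text \<open>The exponent is r / (4 \<pi> i) times the constant 4 \<pi>^2 j. For odd r, the integers
  - r j and j have the same parity.\<close>

lemma exp_minus_odd_pi_i:
  assumes "odd r"
  shows "exp (- \<i> * of_real pi * of_nat r * of_int j) = (-1) powi j"
proof -
  have "exp (- \<i> * of_real pi * of_nat r * of_int j) = exp (\<i> * of_real pi) powi (- (int r * j))"
    unfolding exp_power_int by (simp add: mult_ac)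
  also have "\<dots> = (-1) powi j"
    using assms by (simp add: power_int_minus_left)
  finally show ?thesis .
qed

theorem proposition4p5:
  fixes p' p q pt qt :: int and a :: "nat \<Rightarrow> int" and k r :: nat
    and \<eta> \<epsilon> :: real and \<psi> :: "real \<times> real \<times> real \<Rightarrow> real"
    and s m n l :: int
  assumes "coprime p q" and "q \<noteq> 0"
    and "arithmetic_data p q pt qt a k"
    and "r \<ge> 3" and "odd r"
    and "0 < \<eta>" and "\<eta> < 1"
    and "\<epsilon> > 0" and "cutoff \<epsilon> \<psi>"
    and "s \<in> {0..\<bar>q\<bar> - 1}"
  shows "fourier_coeff \<eta> \<epsilon> \<psi> r p' p q a k s m n l =
         (-1) powi (p' + l) * fourier_coeff \<eta> \<epsilon> \<psi> r p' p q a k s m n (- 2 * p' - 2 - l)"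
proof -
  define l' where "l' = - 2 * p' - 2 - l"
  define A :: "int \<Rightarrow> real \<Rightarrow> real \<Rightarrow> real \<Rightarrow> complex" where
    "A l x y z = - \<i> * of_real (x + y)
       + of_nat r / (4 * of_real pi * \<i>) * potential \<eta> r p' p q a k x y z s m n l" for l x y z
  define g :: "int \<Rightarrow> real \<times> real \<times> real \<Rightarrow> complex" where
    "g l v = (case v of (x, y, z) \<Rightarrow>
       of_real (\<psi> (x, y, z) * sin (x / of_int q - J_fun a k q s * pi) * sin (2 * z)) *
       exp (A l x y z))" for l v
  \<comment> \<open>With the indicator absorbed into the integrand, the reflection applies to an
    integral over the whole space.\<close>
  define G where "G l v = indicat_real (D_region (\<epsilon> / 2)) v *\<^sub>R g l v" for l v
  have \<psi>: "\<psi> (x, y, pi - z) = \<psi> (x, y, z)" for x y z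
    using \<open>cutoff \<epsilon> \<psi>\<close> unfolding cutoff_def by metis
  have "A l' x y (pi - z) = A l x y z + - \<i> * of_real pi * of_nat r * of_int (p' + 1 + l)" for x y z
    unfolding A_def l'_def potential_reflect
    by (simp add: field_simps power2_eq_square)
  then have exp_A: "exp (A l' x y (pi - z)) = (-1) powi (p' + 1 + l) * exp (A l x y z)" for x y z
    using exp_minus_odd_pi_i[OF \<open>odd r\<close>, of "p' + 1 + l"] by (simp only: exp_add mult.commute)
  have sin: "sin (2 * (pi - z)) = - sin (2 * z)" for z :: real
    by (simp add: right_diff_distrib sin_diff)
  \<comment> \<open>This extra sign cancels the one from sin (2 z), which leaves the exponent p' +
    l.\<close>
  have powi: "(-1) powi (p' + 1 + l) = (- ((-1) powi (p' + l)) :: complex)"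
    by (simp add: power_int_minus_left)
  have G: "G l' (x, y, pi - z) = (-1) powi (p' + l) * G l (x, y, z)" for x y z
    unfolding G_def g_def using D_region_reflect[of x y z]
    by (simp add: \<psi> exp_A sin powi indicator_def)
  have "(\<integral>v. G l' v \<partial>lborel) = (\<integral>v. G l' (fst v, fst (snd v), pi - snd (snd v)) \<partial>lborel)"
    by (rule lborel_integral_reflect_third[symmetric])
  also have "\<dots> = (-1) powi (p' + l) * (\<integral>v. G l v \<partial>lborel)"
    by (simp add: G)
  finally have "(-1) powi (p' + l) * (\<integral>v. G l' v \<partial>lborel) = (\<integral>v. G l v \<partial>lborel)"
    by (simp add: power_int_minus_left)
  \<comment> \<open>The difference l' - l = - 2 (p' + 1 + l) is even, so both coefficients carry the
    same prefactor.\<close>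
  moreover have "(-1) powi (m + n + l') = ((-1) powi (m + n + l) :: complex)"
    by (simp add: l'_def power_int_minus_left)
  moreover have "fourier_coeff \<eta> \<epsilon> \<psi> r p' p q a k s m n l =
      4 * (-1) powi (m + n + l) * (of_nat r / (2 * of_real pi)) ^ 3 * (\<integral>v. G l v \<partial>lborel)" for l
    unfolding fourier_coeff_def set_lebesgue_integral_def G_def g_def A_def ..
  ultimately show ?thesis
    unfolding l'_def[symmetric] by (simp add: mult_ac)
qed

end
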